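(* Let $L$ be a set of $n$ lines in the real projective plane in general position (no three of the lines pass through a common point), and let $\mathcal{A}(L)$ be the arrangement of vertices, edges and faces they determine. Then $C(L)\le 5$; that is, there exists a vertex $v$ of $\mathcal{A}(L)$ such that, if $\ell_1^v,\ell_2^v$ are the two lines of $L$ passing through $v$, the face of the arrangement $\mathcal{A}(L\setminus\{\ell_1^v,\ell_2^v\})$ containing the point $v$ has size at most $5$.
   Context: For a set of lines $L$, $\mathcal{A}(L)$ denotes the cell decomposition of the projective plane induced by the lines; its vertices are the pairwise intersection points of lines in $L$. The size of a face is its number of edges (equivalently, of vertices on its boundary). For a vertex $v\in\mathcal{A}(L)$ lying on the lines $\ell_1^v,\ell_2^v\in L$, the zone complexity $C(v)$ is the size of the face of $\mathcal{A}(L\setminus\{\ell_1^v,\ell_2^v\})$ containing the point $v$, and $C(L)=\min_{v} C(v)$ over all vertices $v$ of $\mathcal{A}(L)$ (so $L$ is assumed to contain at least two lines). *)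

theory Defs
  imports "HOL-Analysis.Analysis"
begin

text \<open>Model of the real projective plane: the unit sphere S^2 in R^3 (its double cover),
  with antipodal points identified implicitly. A projective line is represented by the
  great circle it lifts to.\<close>

definition S2 :: "(real^3) set" where
  "S2 = sphere 0 1"

definition is_proj_line :: "(real^3) set \<Rightarrow> bool" where
  "is_proj_line l \<longleftrightarrow> (\<exists>a::real^3. a \<noteq> 0 \<and> l = {x \<in> S2. a \<bullet> x = 0})"

definition general_position :: "(real^3) set set \<Rightarrow> bool" where
  "general_position L \<longleftrightarrow>
     (\<forall>l1\<in>L. \<forall>l2\<in>L. \<forall>l3\<in>L. l1 \<noteq> l2 \<and> l1 \<noteq> l3 \<and> l2 \<noteq> l3 \<longrightarrow> l1 \<inter> l2 \<inter> l3 = {})"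

definition arr_vertices :: "(real^3) set set \<Rightarrow> (real^3) set" where
  "arr_vertices L = {x. \<exists>l1\<in>L. \<exists>l2\<in>L. l1 \<noteq> l2 \<and> x \<in> l1 \<and> x \<in> l2}"

definition face_at :: "(real^3) set set \<Rightarrow> real^3 \<Rightarrow> (real^3) set" where
  "face_at L x = connected_component_set (S2 - \<Union>L) x"

definition face_size :: "(real^3) set set \<Rightarrow> real^3 \<Rightarrow> nat" where
  "face_size L x = card {v \<in> arr_vertices L. v \<in> closure (face_at L x)}"

definition zone_complexity :: "(real^3) set set \<Rightarrow> real^3 \<Rightarrow> nat" where
  "zone_complexity L v = face_size {l \<in> L. v \<notin> l} v"

definition C :: "(real^3) set set \<Rightarrow> nat" where
  "C L = Min (zone_complexity L ` arr_vertices L)"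

end

theory Submission
  imports Defs
begin

text \<open>Removing the two lines through a vertex \<open>v\<close> merges the four faces around \<open>v\<close> into one, and each of
  them loses exactly three vertices (\<open>v\<close> and its two neighbours), so the zone complexity of \<open>v\<close> is the
  sum of the four degrees minus 12. Suppose all these sums were at least 18. On the sphere
  there are more faces than vertices (sending a vertex to the face for which it comes first in a
  rotating sweep is injective but not surjective), and every vertex lies on four faces,
  so the sum of \<open>deg - 4\<close> over all faces is negative. This is refuted by discharging: faces of degree at
  least 5 give charge to their vertices, which pass it on to the triangles there. A face gives no more
  than \<open>deg - 4\<close>, while every triangle receives at least 1. The geometry enters through two facts: triangles
  do not share an edge, and opposite edges of a quadrilateral do not both border triangles. By the
  latter, the end points of an edge of a heptagon never both get the largest charge 1/2.\<close>

subsection \<open>Vertices of an arrangement of great circles\<close>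

text \<open>A vector is determined by its dot and cross products with a fixed nonzero vector, and by
  Lagrange's formula the cross product of \<open>x\<close> with \<open>cross3 a b\<close>
  vanishes.\<close>

lemma orthogonal_both_cross:
  fixes a b x :: "real^3"
  assumes "cross3 a b \<noteq> 0" "a \<bullet> x = 0" "b \<bullet> x = 0"
  obtains k where "x = k *\<^sub>R cross3 a b"
proof -
  define d where "d = cross3 a b"
  have d: "d \<bullet> d \<noteq> 0"
    using assms(1) by (simp add: d_def)
  define k where "k = (x \<bullet> d) / (d \<bullet> d)"
  have 1: "d \<bullet> x = d \<bullet> (k *\<^sub>R d)"
    using d by (simp add: k_def inner_commute)
  have "cross3 x d = 0"
    unfolding d_def Lagrange using assms by (simp add: inner_commute)
  then have 2: "cross3 d x = cross3 d (k *\<^sub>R d)"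
    using cross_skew[of d x] by (simp add: cross_mult_right)
  have "x = k *\<^sub>R d"
    using d by (intro cross_dot_cancel[OF 1 2]) auto
  then show thesis
    using that d_def by blast
qed

lemma unit_scaleR_cases:
  fixes d :: "'a::real_normed_vector"
  assumes "norm (p *\<^sub>R d) = 1" "norm (q *\<^sub>R d) = 1"
  shows "p *\<^sub>R d = q *\<^sub>R d \<or> p *\<^sub>R d = - (q *\<^sub>R d)"
proof -
  have "norm d \<noteq> 0" "\<bar>p\<bar> * norm d = \<bar>q\<bar> * norm d"
    using assms by auto
  then have "\<bar>p\<bar> = \<bar>q\<bar>"
    by simp
  then show ?thesis
    by (auto simp: abs_eq_iff)
qed

text \<open>Lines are labels carrying chosen normals, so that the same lines can be studied under
  different orientations. Every projective vertex occurs as a pair of antipodal points.\<close>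

locale great_circles =
  fixes L :: "'l set" and N :: "'l \<Rightarrow> real^3"
  assumes finite_L: "finite L"
    and cross_nonzero: "\<lbrakk>l \<in> L; m \<in> L; l \<noteq> m\<rbrakk> \<Longrightarrow> cross3 (N l) (N m) \<noteq> 0"
    and no_three: "\<lbrakk>k \<in> L; l \<in> L; m \<in> L; k \<noteq> l; k \<noteq> m; l \<noteq> m;
        N k \<bullet> x = 0; N l \<bullet> x = 0; N m \<bullet> x = 0\<rbrakk> \<Longrightarrow> x = 0"
begin

definition verts :: "(real^3) set" where
  "verts = {x. norm x = 1 \<and> (\<exists>l\<in>L. \<exists>m\<in>L. l \<noteq> m \<and> N l \<bullet> x = 0 \<and> N m \<bullet> x = 0)}"

definition lines :: "real^3 \<Rightarrow> 'l set" where
  "lines x = {l \<in> L. N l \<bullet> x = 0}"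

lemma vertsE:
  assumes "x \<in> verts"
  obtains i j where "i \<in> L" "j \<in> L" "i \<noteq> j" "lines x = {i, j}" "norm x = 1"
proof -
  obtain i j where ij: "i \<in> L" "j \<in> L" "i \<noteq> j" "N i \<bullet> x = 0" "N j \<bullet> x = 0" and n: "norm x = 1"
    using assms by (auto simp: verts_def)
  have "lines x = {i, j}"
    using ij n no_three[of i j _ x] by (fastforce simp: lines_def)
  then show thesis
    using that ij n by blast
qed

lemma lines_subset: "lines x \<subseteq> L"
  by (auto simp: lines_def)

lemma lines_other:
  assumes "x \<in> verts" "i \<in> lines x"
  obtains j where "j \<in> L" "i \<noteq> j" "lines x = {i, j}"
  using assms by (elim vertsE) (metis empty_iff insert_commute insert_iff)

lemma on_two_lines:
  assumes "v \<in> verts" "i \<in> lines v" "j \<in> lines v" "i \<noteq> j"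
  shows "lines v = {i, j}"
proof -
  obtain k where "lines v = {i, k}"
    using lines_other[OF assms(1,2)] by metis
  then show ?thesis
    using assms(3,4) by auto
qed

lemma card_lines: "x \<in> verts \<Longrightarrow> card (lines x) = 2"
  by (elim vertsE) simp

lemma finite_lines: "finite (lines x)"
  using finite_L lines_subset finite_subset by blast

lemma verts_norm: "x \<in> verts \<Longrightarrow> norm x = 1"
  by (simp add: verts_def)

lemma lines_cross:
  assumes "x \<in> verts" "lines x = {i, j}" "i \<noteq> j"
  obtains k where "x = k *\<^sub>R cross3 (N i) (N j)" "k \<noteq> 0"
proof -
  have "i \<in> L" "j \<in> L" "N i \<bullet> x = 0" "N j \<bullet> x = 0"
    using assms by (auto simp: lines_def)
  then obtain k where "x = k *\<^sub>R cross3 (N i) (N j)"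
    using orthogonal_both_cross[OF cross_nonzero] assms(3) by blast
  moreover have "k \<noteq> 0"
    using calculation verts_norm[OF assms(1)] by auto
  ultimately show thesis
    using that by blast
qed

text \<open>Both points are unit multiples of the same cross product.\<close>

lemma same_lines:
  assumes "x \<in> verts" "y \<in> verts" "lines x = lines y"
  shows "x = y \<or> x = - y"
proof -
  obtain i j where ij: "i \<noteq> j" "lines x = {i, j}"
    using assms(1) by (elim vertsE) blast
  obtain p where p: "x = p *\<^sub>R cross3 (N i) (N j)"
    using lines_cross[OF assms(1) ij(2,1)] by blast
  obtain q where q: "y = q *\<^sub>R cross3 (N i) (N j)"
    using lines_cross[OF assms(2) ij(2)[unfolded assms(3)] ij(1)] by blast
  show ?thesis
    using verts_norm[OF assms(1)] verts_norm[OF assms(2)] unfolding p q by (rule unit_scaleR_cases)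
qed

lemma finite_verts: "finite verts"
proof -
  have "verts \<subseteq> (\<Union>A\<in>Pow L. {x \<in> verts. lines x = A})"
    using lines_subset by auto
  moreover have "finite {x \<in> verts. lines x = A}" for A
  proof (cases "{x \<in> verts. lines x = A} = {}")
    case False
    then obtain y where "y \<in> verts" "lines y = A" by auto
    then have "{x \<in> verts. lines x = A} \<subseteq> {y, -y}"
      using same_lines by auto
    then show ?thesis
      using finite_subset by blast
  next
    case True
    then show ?thesis by (metis finite.emptyI)
  qed
  ultimately show ?thesis
    using finite_L by (meson finite_Pow_iff finite_UN finite_subset)
qed

lemma ex_vertex:
  assumes "2 \<le> card L"
  shows "verts \<noteq> {}"
proof -
  obtain l m where lm: "l \<in> L" "m \<in> L" "l \<noteq> m"
    using assms by (metis One_nat_def card_le_Suc0_iff_eq finite_L not_less_eq_eq numeral_2_eq_2)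
  define d where "d = cross3 (N l) (N m)"
  have "d \<noteq> 0"
    using cross_nonzero[OF lm] by (simp add: d_def)
  moreover have "N l \<bullet> d = 0" "N m \<bullet> d = 0"
    by (simp_all add: d_def dot_cross_self)
  ultimately have "d /\<^sub>R norm d \<in> verts"
    using lm by (auto simp: verts_def)
  then show ?thesis by blast
qed

text \<open>This settles arrangements of at most four lines: without the two lines through a vertex,
  at most two remain.\<close>

lemma card_verts_le_2:
  assumes "card L \<le> 2"
  shows "card verts \<le> 2"
proof (cases "verts = {}")
  case False
  then obtain x where x: "x \<in> verts"
    by blast
  have "lines y = L" if "y \<in> verts" for y
    using card_seteq[OF finite_L lines_subset] card_lines[OF that] assms by simp
  then have "verts \<subseteq> {x, - x}"
    using same_lines[OF _ x] x by auto
  then have "card verts \<le> card {x, - x}"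
    by (intro card_mono) auto
  also have "\<dots> \<le> 2"
    by (simp add: card_insert_if)
  finally show ?thesis .
qed simp

text \<open>A small step from \<open>v\<close> off its two lines crosses no other line and ends
  inside a cell with corner \<open>v\<close>. Normals turned towards the point reached make this the
  cell encoded by \<open>L\<close>.\<close>

lemma ex_pole:
  assumes "v \<in> verts"
  shows "\<exists>x. \<forall>l\<in>L. N l \<bullet> x \<noteq> 0 \<and> 0 \<le> (N l \<bullet> x) * (N l \<bullet> v)"
proof -
  obtain i j where ij: "i \<in> L" "j \<in> L" "i \<noteq> j" "lines v = {i, j}"
    using assms by (elim vertsE) blast
  obtain k where k: "v = k *\<^sub>R cross3 (N i) (N j)" "k \<noteq> 0"
    using lines_cross[OF assms ij(4,3)] by blast
  \<comment> \<open>The summands are tangent to the two lines at \<open>v\<close>; the sum leaves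
    both.\<close>
  define d where "d = cross3 (N i) v + cross3 (N j) v"
  have "N i \<bullet> d = k * (norm (cross3 (N i) (N j)))\<^sup>2" "N j \<bullet> d = - (k * (norm (cross3 (N i) (N j)))\<^sup>2)"
    unfolding d_def k(1) power2_norm_eq_inner by (simp_all add: cross3_simps)
  then have d: "N i \<bullet> d \<noteq> 0" "N j \<bullet> d \<noteq> 0"
    using k(2) cross_nonzero[OF ij(1-3)] by simp_all
  have "\<forall>\<^sub>F t in at_right 0. N l \<bullet> (v + t *\<^sub>R d) \<noteq> 0 \<and> 0 \<le> (N l \<bullet> (v + t *\<^sub>R d)) * (N l \<bullet> v)"
    if l: "l \<in> L" for l
  proof (cases "N l \<bullet> v = 0")
    case True
    then have "l \<in> lines v"
      using l by (simp add: lines_def)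
    then have "N l \<bullet> d \<noteq> 0"
      using ij(4) d by auto
    then show ?thesis
      using True eventually_at_right_less[of "0::real"] by (auto elim!: eventually_mono simp: inner_add_right)
  next
    case False
    have "((\<lambda>t. (N l \<bullet> (v + t *\<^sub>R d)) * (N l \<bullet> v)) \<longlongrightarrow> (N l \<bullet> (v + 0 *\<^sub>R d)) * (N l \<bullet> v)) (at_right 0)"
      by (intro tendsto_intros)
    moreover have "0 < (N l \<bullet> (v + 0 *\<^sub>R d)) * (N l \<bullet> v)"
      using False by (auto simp: zero_less_mult_iff linorder_neq_iff)
    ultimately have "\<forall>\<^sub>F t in at_right 0. 0 < (N l \<bullet> (v + t *\<^sub>R d)) * (N l \<bullet> v)"
      by (rule order_tendstoD(1))
    then show ?thesis
      by (rule eventually_mono) auto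
  qed
  then have "\<forall>\<^sub>F t in at_right (0::real). \<forall>l\<in>L.
      N l \<bullet> (v + t *\<^sub>R d) \<noteq> 0 \<and> 0 \<le> (N l \<bullet> (v + t *\<^sub>R d)) * (N l \<bullet> v)"
    using finite_L by (simp add: eventually_ball_finite)
  then show ?thesis
    using eventually_happens[of _ "at_right (0::real)"] by force
qed

lemma great_circles_subset:
  assumes "L' \<subseteq> L"
  shows "great_circles L' N"
proof
  show "finite L'"
    using finite_L assms by (rule finite_subset[rotated])
  show "cross3 (N l) (N m) \<noteq> 0" if "l \<in> L'" "m \<in> L'" "l \<noteq> m" for l m
    using cross_nonzero that assms by blast
  show "x = 0" if "k \<in> L'" "l \<in> L'" "m \<in> L'" "k \<noteq> l" "k \<noteq> m" "l \<noteq> m"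
    "N k \<bullet> x = 0" "N l \<bullet> x = 0" "N m \<bullet> x = 0" for k l m x
    using no_three[OF _ _ _ that(4-9)] that(1-3) assms by blast
qed

end

subsection \<open>Cells, edges and triangles\<close>

text \<open>Besides any four lines there is a fifth, and its sides tell a point off it from the
  antipode.\<close>

locale line_arrangement = great_circles L N for L :: "'l set" and N +
  assumes card_L: "5 \<le> card L"
begin

text \<open>A cell of the arrangement is encoded by the set \<open>c\<close> of lines on whose positive side it lies;
  only sets incident to some vertex in the following sense are actual cells.\<close>

definition inc :: "real^3 \<Rightarrow> 'l set \<Rightarrow> bool" where
  "inc x c \<longleftrightarrow> x \<in> verts \<and> c \<subseteq> L \<and> (\<forall>l\<in>L. if l \<in> c then 0 \<le> N l \<bullet> x else N l \<bullet> x \<le> 0)"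

definition corners :: "'l set \<Rightarrow> (real^3) set" where
  "corners c = {x. inc x c}"

definition deg :: "'l set \<Rightarrow> nat" where
  "deg c = card (corners c)"

text \<open>Crossing the line \<open>l\<close>: at a corner of \<open>c\<close> on \<open>l\<close>,
  this is the cell on the other side of \<open>l\<close>.\<close>

definition flip :: "'l set \<Rightarrow> 'l \<Rightarrow> 'l set" where
  "flip c l = (if l \<in> c then c - {l} else insert l c)"

lemma flip_flip [simp]: "flip (flip c l) l = c"
  by (auto simp: flip_def)

lemma flip_commute: "flip (flip c l) m = flip (flip c m) l"
  by (auto simp: flip_def)

lemma in_flip_iff: "m \<in> flip c l \<longleftrightarrow> (if m = l then m \<notin> c else m \<in> c)"
  by (auto simp: flip_def)

lemma flip_neq [simp]: "flip c l \<noteq> c"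
  by (auto simp: flip_def)

lemma flip_eq_iff [simp]: "flip c l = flip c m \<longleftrightarrow> l = m"
  by (auto simp: flip_def split: if_splits)

lemma inc_verts: "inc x c \<Longrightarrow> x \<in> verts"
  by (simp add: inc_def)

lemma not_subset_small: "finite A \<Longrightarrow> card A \<le> 4 \<Longrightarrow> \<not> L \<subseteq> A"
  using card_L card_mono[of A L] by linarith

lemma inc_strict:
  assumes "inc x c" "e \<in> L" "e \<notin> lines x"
  shows "if e \<in> c then 0 < N e \<bullet> x else N e \<bullet> x < 0"
proof -
  have "N e \<bullet> x \<noteq> 0" "if e \<in> c then 0 \<le> N e \<bullet> x else N e \<bullet> x \<le> 0"
    using assms by (auto simp: inc_def lines_def)
  then show ?thesis by (simp split: if_splits)
qed

text \<open>The points are equal or antipodal, and antipodal points off \<open>e\<close> lie on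
  opposite sides of it. The cells may differ elsewhere, which serves to identify corners of two
  different triangles.\<close>

lemma same_lines_inc:
  assumes "inc x c" "inc y c'" "lines x = lines y" "e \<in> L" "e \<notin> lines x" "e \<in> c \<longleftrightarrow> e \<in> c'"
  shows "x = y"
proof -
  have "x = y \<or> x = - y"
    using same_lines[of x y] inc_verts[OF assms(1)] inc_verts[OF assms(2)] assms(3) by blast
  moreover have "x \<noteq> - y"
  proof
    assume "x = - y"
    then have "N e \<bullet> x = - (N e \<bullet> y)"
      by simp
    then show False
      using inc_strict[OF assms(1,4,5)] inc_strict[OF assms(2,4) assms(5)[unfolded assms(3)]] assms(6)
      by (simp split: if_splits)
  qed
  ultimately show ?thesis by blast
qed

lemma same_lines_inc_cell:
  assumes "inc x c" "inc y c" "lines x = lines y"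
  shows "x = y"
proof -
  obtain e where "e \<in> L" "e \<notin> lines x"
    using not_subset_small[of "lines x"] card_lines[OF inc_verts[OF assms(1)]] finite_lines by auto
  then show ?thesis
    using same_lines_inc[OF assms] by blast
qed

lemma finite_corners: "finite (corners c)"
  using finite_verts by (rule finite_subset[rotated]) (auto simp: corners_def inc_def)

section \<open>Crossing lines, and the edges of a cell\<close>

lemma inc_flip: "inc x c \<Longrightarrow> i \<in> lines x \<Longrightarrow> inc x (flip c i)"
  by (auto simp: inc_def flip_def lines_def)

lemma inc_flip_iff: "i \<in> lines x \<Longrightarrow> inc x (flip c i) \<longleftrightarrow> inc x c"
  using inc_flip[of x c i] inc_flip[of x "flip c i" i] by auto

lemma inc_differ:
  assumes "inc x c" "inc x c'" "l \<in> L" "l \<in> c \<longleftrightarrow> l \<notin> c'"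
  shows "l \<in> lines x"
  using assms by (force simp: inc_def lines_def split: if_splits)

text \<open>Up to scaling, the points \<open>t *\<^sub>R v + d\<close> with decreasing
  \<open>t\<close> run from \<open>v\<close> along the line \<open>i\<close>, on the side of
  \<open>j\<close> where \<open>c\<close> lies. Every further line \<open>l\<close> bounds
  \<open>t\<close> from below by \<open>r l\<close>, and the largest bound \<open>s\<close> gives
  the end of the edge. Any other corner of \<open>c\<close> on \<open>i\<close> has \<open>t\<close>
  at least \<open>s\<close>, being on the right side of all lines, and at most \<open>s\<close>,
  lying on one of them.\<close>

lemma edge_ex1:
  assumes "inc v c" "i \<in> lines v"
  shows "\<exists>!w. inc w c \<and> i \<in> lines w \<and> w \<noteq> v"
proof -
  have v: "v \<in> verts" "norm v = 1" and c: "c \<subseteq> L"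
    using assms(1) verts_norm by (auto simp: inc_def)
  obtain j where j: "j \<in> L" "i \<noteq> j" "lines v = {i, j}"
    using lines_other[OF v(1) assms(2)] by blast
  have i: "i \<in> L" "N i \<bullet> v = 0"
    using assms(2) by (auto simp: lines_def)
  define A where "A l = (if l \<in> c then N l else - N l)" for l
  have inc_A: "inc w c \<longleftrightarrow> w \<in> verts \<and> (\<forall>l\<in>L. 0 \<le> A l \<bullet> w)" for w
    using c by (simp add: inc_def A_def)
  have A_0: "A l \<bullet> w = 0 \<longleftrightarrow> N l \<bullet> w = 0" for l w
    by (simp add: A_def)
  obtain k where k: "v = k *\<^sub>R cross3 (N i) (N j)" "k \<noteq> 0"
    using lines_cross[OF v(1) j(3,2)] by blast
  define d0 where "d0 = cross3 (N i) v"
  have Nj: "N j \<bullet> d0 \<noteq> 0"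
  proof -
    have "N j \<bullet> d0 = - (cross3 (N i) (N j) \<bullet> v)"
      unfolding d0_def by (simp add: cross3_simps)
    also have "\<dots> = - (k * (norm (cross3 (N i) (N j)))\<^sup>2)"
      unfolding k(1) by (simp add: power2_norm_eq_inner)
    also have "\<dots> \<noteq> 0"
      using k(2) cross_nonzero[OF i(1) j(1,2)] by simp
    finally show ?thesis .
  qed
  \<comment> \<open>Of the two directions along \<open>i\<close>, the one towards the side of
    \<open>j\<close> on which \<open>c\<close> lies.\<close>
  define d where "d = (if 0 < A j \<bullet> d0 then d0 else - d0)"
  have Ajd: "0 < A j \<bullet> d"
    using Nj by (auto simp: d_def A_def)
  have d_i: "N i \<bullet> d = 0"
    by (simp add: d_def d0_def dot_cross_self)
  have Ajv: "A j \<bullet> v = 0" and Aiv: "A i \<bullet> v = 0" and Aid: "A i \<bullet> d = 0"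
    using j i d_i by (auto simp: A_0 lines_def)
  have span: "\<exists>p q. w = p *\<^sub>R v + q *\<^sub>R d" if "N i \<bullet> w = 0" for w
  proof -
    define q where "q = (A j \<bullet> w) / (A j \<bullet> d)"
    have "A j \<bullet> (w - q *\<^sub>R d) = 0"
      using Ajd by (simp add: q_def inner_diff_right)
    then have "N j \<bullet> (w - q *\<^sub>R d) = 0"
      by (simp only: A_0)
    moreover have "N i \<bullet> (w - q *\<^sub>R d) = 0"
      using that d_i by (simp add: inner_diff_right)
    ultimately obtain p where "w - q *\<^sub>R d = p *\<^sub>R cross3 (N i) (N j)"
      using orthogonal_both_cross[OF cross_nonzero[OF i(1) j(1,2)]] by blast
    then have "w - q *\<^sub>R d = (p / k) *\<^sub>R v"
      using k(2) by (subst k(1)) simp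
    then show ?thesis
      by (metis diff_add_cancel)
  qed
  define M where "M = L - {i, j}"
  have M: "finite M" "M \<noteq> {}"
    using finite_L not_subset_small[of "{i,j}"] j(2) by (auto simp: M_def)
  have pos: "0 < A l \<bullet> v" if "l \<in> M" for l
    using inc_strict[OF assms(1), of l] that j(3) by (auto simp: M_def A_def split: if_splits)
  define r where "r l = - (A l \<bullet> d) / (A l \<bullet> v)" for l
  define s where "s = Max (r ` M)"
  have s_ge: "r l \<le> s" if "l \<in> M" for l
    using M that by (simp add: s_def)
  have "s \<in> r ` M"
    using M by (simp add: s_def)
  then obtain m where m: "m \<in> M" "s = r m" by auto
  have sign: "0 \<le> A l \<bullet> (t *\<^sub>R v + d) \<longleftrightarrow> r l \<le> t" "A l \<bullet> (t *\<^sub>R v + d) = 0 \<longleftrightarrow> r l = t"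
    if "l \<in> M" for l t
    using pos[OF that] by (auto simp: r_def inner_add_right field_simps)
  have "d \<noteq> 0"
    using Ajd by auto
  define u where "u = s *\<^sub>R v + d"
  have Aju: "A j \<bullet> u = A j \<bullet> d"
    using Ajv by (simp add: u_def inner_add_right)
  have u: "u \<noteq> 0"
    using Aju Ajd by auto
  define w where "w = u /\<^sub>R norm u"
  have Aw: "A l \<bullet> w = (A l \<bullet> u) / norm u" for l
    by (simp add: w_def divide_inverse mult.commute)
  have Amu: "A m \<bullet> u = 0"
    using sign(2)[OF m(1), of s] m(2) by (simp add: u_def)
  have Aiu: "A i \<bullet> u = 0"
    using Aiv Aid by (simp add: u_def inner_add_right)
  have Au: "0 \<le> A l \<bullet> u" if "l \<in> L" for l
    using that Aiu Aju Ajd sign(1)[of l s] s_ge[of l] by (cases "l \<in> M") (auto simp: M_def u_def)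
  have "norm w = 1"
    using u by (simp add: w_def)
  moreover have "N i \<bullet> w = 0" "N m \<bullet> w = 0"
    using Aw[of i] Aw[of m] Aiu Amu by (simp_all flip: A_0)
  moreover have "m \<in> L" "i \<noteq> m"
    using m(1) by (auto simp: M_def)
  ultimately have wv: "w \<in> verts"
    using i(1) by (auto simp: verts_def)
  have "inc w c \<and> i \<in> lines w \<and> w \<noteq> v"
  proof (intro conjI)
    show "inc w c"
      unfolding inc_A using wv Au by (simp add: Aw)
    show "i \<in> lines w"
      using i(1) Aw[of i] Aiu by (simp add: lines_def flip: A_0)
    have "A j \<bullet> w \<noteq> 0"
      using Aw[of j] Aju Ajd u by simp
    then show "w \<noteq> v"
      using Ajv by auto
  qed
  moreover have "y = w" if y: "inc y c" "i \<in> lines y" "y \<noteq> v" for y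
  proof -
    have yv: "y \<in> verts" "norm y = 1" and yL: "\<And>l. l \<in> L \<Longrightarrow> 0 \<le> A l \<bullet> y"
      using y(1) verts_norm by (auto simp: inc_A)
    have "N i \<bullet> y = 0"
      using y(2) by (simp add: lines_def)
    then obtain p q where pq: "y = p *\<^sub>R v + q *\<^sub>R d"
      using span by blast
    have Ajy: "A j \<bullet> y = q * (A j \<bullet> d)"
      using Ajv by (simp add: pq inner_add_right)
    have "q \<noteq> 0"
    proof
      assume "q = 0"
      then have "A j \<bullet> y = 0"
        using Ajy by simp
      then have "j \<in> lines y"
        using j(1) by (simp add: lines_def A_0)
      then have "lines y = lines v"
        using on_two_lines[OF yv(1) y(2)] j by simp
      then show False
        using same_lines_inc_cell[OF y(1) assms(1)] y(3) by blast
    qed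
    moreover have "0 \<le> q"
      using yL[OF j(1)] Ajy Ajd by (simp add: zero_le_mult_iff)
    ultimately have q: "0 < q"
      by simp
    define t where "t = p / q"
    have yt: "y = q *\<^sub>R (t *\<^sub>R v + d)"
      using q by (simp add: pq t_def scaleR_add_right)
    have "s \<le> t"
      using yL[of m] m q sign(1)[OF m(1), of t] by (simp add: yt M_def zero_le_mult_iff)
    moreover obtain l where l: "l \<in> L" "i \<noteq> l" "lines y = {i, l}"
      using lines_other[OF yv(1) y(2)] by blast
    have "l \<in> lines y"
      using l(3) by simp
    then have Aly: "A l \<bullet> y = 0"
      by (simp add: A_0 lines_def)
    have "l \<noteq> j"
      using Aly Ajy q Ajd by auto
    then have lM: "l \<in> M"
      using l by (simp add: M_def)
    have "r l = t"
      using Aly q sign(2)[OF lM, of t] by (simp add: yt)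
    ultimately have "t = s"
      using s_ge[OF lM] by simp
    then have yu: "y = q *\<^sub>R u"
      by (simp add: yt u_def)
    then have "q * norm u = 1"
      using yv(2) q by simp
    then have "q = inverse (norm u)"
      using u by (simp add: field_simps)
    then show "y = w"
      by (simp add: yu w_def)
  qed
  ultimately show ?thesis
    by blast
qed

text \<open>The other end of the edge of \<open>c\<close> that leaves \<open>v\<close> along
  \<open>i\<close>; \<open>edge_ex1\<close> makes it well defined.\<close>

definition nb :: "'l set \<Rightarrow> real^3 \<Rightarrow> 'l \<Rightarrow> real^3" where
  "nb c v i = (THE w. inc w c \<and> i \<in> lines w \<and> w \<noteq> v)"

lemma nb:
  assumes "inc v c" "i \<in> lines v"
  shows "inc (nb c v i) c" "i \<in> lines (nb c v i)" "nb c v i \<noteq> v"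
  using theI'[OF edge_ex1[OF assms]] unfolding nb_def by blast+

lemma nb_eqI:
  assumes "inc v c" "i \<in> lines v" "inc w c" "i \<in> lines w" "w \<noteq> v"
  shows "w = nb c v i"
  using edge_ex1[OF assms(1,2)] assms(3-5) nb[OF assms(1,2)] by blast

lemma nb_nb:
  assumes "inc v c" "i \<in> lines v"
  shows "nb c (nb c v i) i = v"
  using nb_eqI[of "nb c v i" c i v] nb[OF assms] assms by metis

lemma same_cell_eqI:
  assumes "inc v c" "inc w c" "i \<in> lines v" "j \<in> lines v" "i \<in> lines w" "j \<in> lines w" "i \<noteq> j"
  shows "v = w"
  using same_lines_inc_cell[OF assms(1,2)] on_two_lines[of v i j] on_two_lines[of w i j] assms inc_verts
  by metis

lemma corners_iff: "x \<in> corners c \<longleftrightarrow> inc x c"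
  by (simp add: corners_def)

lemma nb_distinct:
  assumes "inc v c" "i \<in> lines v" "j \<in> lines v" "i \<noteq> j"
  shows "nb c v i \<noteq> nb c v j"
  using same_cell_eqI[of v c "nb c v i" i j] nb[of v c] assms by metis

text \<open>A corner on \<open>i\<close> or \<open>j\<close> other than \<open>v\<close> is the
  neighbour of \<open>v\<close> on that line. The two neighbours differ because two lines meet in at
  most one corner of a cell, so 3 counts \<open>v\<close> and its neighbours.\<close>

lemma deg_decompose:
  assumes "inc v c" "lines v = {i, j}" "i \<noteq> j"
  shows "deg c = 3 + card {w \<in> corners c. i \<notin> lines w \<and> j \<notin> lines w}"
proof -
  let ?S = "{v, nb c v i, nb c v j}" and ?R = "{w \<in> corners c. i \<notin> lines w \<and> j \<notin> lines w}"
  have ij: "i \<in> lines v" "j \<in> lines v"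
    using assms by auto
  have "card ?S = 3"
    using nb(3)[OF assms(1) ij(1)] nb(3)[OF assms(1) ij(2)] nb_distinct[OF assms(1) ij assms(3)] by auto
  moreover have "corners c = ?S \<union> ?R"
  proof (intro equalityI subsetI)
    fix w assume "w \<in> corners c"
    then show "w \<in> ?S \<union> ?R"
      using nb_eqI[OF assms(1) ij(1), of w] nb_eqI[OF assms(1) ij(2), of w]
      unfolding corners_iff by blast
  next
    fix w assume "w \<in> ?S \<union> ?R"
    then show "w \<in> corners c"
      using nb(1)[OF assms(1) ij(1)] nb(1)[OF assms(1) ij(2)] assms(1)
      unfolding corners_iff by blast
  qed
  moreover have "?S \<inter> ?R = {}"
    using nb(2)[OF assms(1) ij(1)] nb(2)[OF assms(1) ij(2)] ij by auto
  moreover have "finite ?R"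
    using finite_corners by simp
  ultimately show ?thesis
    unfolding deg_def using card_Un_disjoint[of ?S ?R] by simp
qed

lemma deg_ge_3: "inc v c \<Longrightarrow> 3 \<le> deg c"
proof -
  assume v: "inc v c"
  obtain i j where "i \<noteq> j" "lines v = {i, j}"
    using inc_verts[OF v] by (elim vertsE) blast
  then show "3 \<le> deg c"
    using deg_decompose[OF v] by simp
qed

text \<open>An edge is shared by the cells on its two sides.\<close>

lemma nb_flip:
  assumes "inc v c" "i \<in> lines v"
  shows "nb (flip c i) v i = nb c v i"
proof (rule nb_eqI[symmetric])
  show "inc v (flip c i)"
    using inc_flip[OF assms] .
  show "inc (nb c v i) (flip c i)"
    using inc_flip nb(1,2)[OF assms] by blast
qed (use nb(2,3)[OF assms] assms(2) in auto)

section \<open>Triangles and quadrilaterals\<close>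

lemma nb_lines:
  assumes "inc v c" "lines v = {i, j}" "i \<noteq> j"
  obtains k where "k \<in> L" "k \<noteq> i" "k \<noteq> j" "lines (nb c v i) = {i, k}"
proof -
  have i: "i \<in> lines v" "j \<in> lines v"
    using assms(2) by auto
  note p = nb[OF assms(1) i(1)]
  obtain k where k: "k \<in> L" "i \<noteq> k" "lines (nb c v i) = {i, k}"
    using lines_other[OF inc_verts[OF p(1)] p(2)] by metis
  have "k \<noteq> j"
    using same_cell_eqI[OF p(1) assms(1) p(2) _ i assms(3)] p(3) k(3) by auto
  then show thesis
    using that k by metis
qed

text \<open>The second line \<open>k\<close> through one neighbour of \<open>v\<close> carries an
  edge of \<open>c\<close>; as \<open>k\<close> misses \<open>v\<close>, this edge must end at the
  other neighbour.\<close>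

lemma triangle:
  assumes "deg c = 3" "inc v c" "lines v = {i, j}" "i \<noteq> j"
  obtains k where "k \<in> L" "k \<noteq> i" "k \<noteq> j" "lines (nb c v i) = {i, k}" "lines (nb c v j) = {j, k}"
    "corners c = {v, nb c v i, nb c v j}"
proof -
  have ij: "i \<in> lines v" "j \<in> lines v"
    using assms(3) by auto
  note p = nb[OF assms(2) ij(1)] and q = nb[OF assms(2) ij(2)]
  let ?S = "{v, nb c v i, nb c v j}"
  have "card ?S = 3"
    using p(3) q(3) nb_distinct[OF assms(2) ij assms(4)] by auto
  moreover have "?S \<subseteq> corners c"
    using p(1) q(1) assms(2) by (simp add: corners_iff)
  ultimately have C: "corners c = ?S"
    using assms(1) card_subset_eq[OF finite_corners] unfolding deg_def by metis
  obtain k where k: "k \<in> L" "k \<noteq> i" "k \<noteq> j" "lines (nb c v i) = {i, k}"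
    using nb_lines[OF assms(2-4)] by metis
  define r where "r = nb c (nb c v i) k"
  have kp: "k \<in> lines (nb c v i)"
    using k(4) by simp
  have r: "inc r c" "k \<in> lines r" "r \<noteq> nb c v i"
    using nb[OF p(1) kp] by (auto simp: r_def)
  have "r \<noteq> v"
    using r(2) assms(3) k by auto
  then have "r = nb c v j"
    using r C corners_iff by blast
  then have "lines (nb c v j) = {j, k}"
    using on_two_lines[OF inc_verts[OF q(1)] q(2)] r(2) k(3) by metis
  then show thesis
    using that k C by metis
qed

text \<open>Exactly one corner \<open>e\<close> lies off both lines through \<open>v\<close>. Each
  line through \<open>e\<close> also contains one of the other three corners, hence is
  \<open>i\<close>, \<open>l\<close>, \<open>m\<close> or \<open>k\<close>, and the first two are
  excluded.\<close>

lemma quadrilateral: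
  assumes "deg c = 4" "inc v c" "lines v = {i, l}" "i \<noteq> l" "lines (nb c v i) = {i, m}"
  obtains k e where "k \<in> L" "k \<noteq> i" "k \<noteq> l" "k \<noteq> m" "m \<noteq> i" "m \<noteq> l" "m \<in> L"
    "lines (nb c v l) = {l, k}" "lines e = {m, k}" "inc e c"
proof -
  let ?a = "nb c v i" and ?b = "nb c v l"
  have il: "i \<in> lines v" "l \<in> lines v"
    using assms(3) by auto
  note p = nb[OF assms(2) il(1)] and q = nb[OF assms(2) il(2)]
  obtain m' where m': "m' \<in> L" "m' \<noteq> i" "m' \<noteq> l" "lines ?a = {i, m'}"
    using nb_lines[OF assms(2-4)] by metis
  then have "m' = m"
    using assms(5) by (auto simp: doubleton_eq_iff)
  with m' have m: "m \<in> L" "m \<noteq> i" "m \<noteq> l"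
    by auto
  have "lines v = {l, i}" "l \<noteq> i"
    using assms(3,4) by auto
  then obtain k where k: "k \<in> L" "k \<noteq> l" "k \<noteq> i" "lines ?b = {l, k}"
    using nb_lines[OF assms(2)] by metis
  let ?R = "{w \<in> corners c. i \<notin> lines w \<and> l \<notin> lines w}"
  have "card ?R = 1"
    using deg_decompose[OF assms(2-4)] assms(1) by simp
  then obtain e where e: "?R = {e}"
    by (rule card_1_singletonE)
  have "e \<in> ?R"
    unfolding e by simp
  then have ec: "inc e c" "i \<notin> lines e" "l \<notin> lines e"
    by (simp_all add: corners_iff)
  have rest: "w = v \<or> w = ?a \<or> w = ?b \<or> w = e" if w: "inc w c" for w
  proof (cases "i \<in> lines w \<or> l \<in> lines w")
    case True
    then show ?thesis
      using nb_eqI[OF assms(2) il(1) w] nb_eqI[OF assms(2) il(2) w] by blast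
  next
    case False
    then have "w \<in> ?R"
      using w by (simp add: corners_iff)
    then show ?thesis
      unfolding e by simp
  qed
  have "p = m \<or> p = k" if "p \<in> lines e" for p
  proof -
    note n = nb[OF ec(1) that]
    have "nb c e p = v \<or> nb c e p = ?a \<or> nb c e p = ?b"
      using rest[OF n(1)] n(3) by blast
    then have "p \<in> {i, l} \<or> p \<in> {i, m} \<or> p \<in> {l, k}"
      using n(2) assms(3,5) k(4) by metis
    then show ?thesis
      using that ec by blast
  qed
  then have "lines e \<subseteq> {m, k}"
    by blast
  moreover have card_e: "card (lines e) = 2"
    using card_lines[OF inc_verts[OF ec(1)]] .
  moreover have "card {m, k} \<le> 2"
    by (simp add: card_insert_if)
  ultimately have e_mk: "lines e = {m, k}"
    using card_subset_eq[of "{m, k}" "lines e"] card_mono[of "{m, k}" "lines e"] by simp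
  moreover have "m \<noteq> k"
    using card_e e_mk by auto
  ultimately show thesis
    using that m k ec by metis
qed

text \<open>The third lines of the two triangles agree, since both pass through the end of the
  common edge. A further line shows that the apexes are equal and not antipodal. The common apex is
  on both sides of \<open>i\<close>, hence on \<open>i\<close>, although its lines are
  \<open>j\<close> and \<open>k\<close>.\<close>

lemma no_adjacent_triangles:
  assumes "deg c = 3" "inc v c" "i \<in> lines v"
  shows "deg (flip c i) \<noteq> 3"
proof
  assume d: "deg (flip c i) = 3"
  obtain j where j: "i \<noteq> j" "lines v = {i, j}"
    using lines_other[OF inc_verts[OF assms(2)] assms(3)] by metis
  have v': "inc v (flip c i)"
    using inc_flip assms by blast
  obtain k where k: "k \<in> L" "k \<noteq> i" "k \<noteq> j" "lines (nb c v i) = {i, k}" "lines (nb c v j) = {j, k}"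
    using triangle[OF assms(1,2) j(2,1)] by metis
  obtain k' where k': "k' \<noteq> i" "lines (nb (flip c i) v i) = {i, k'}" "lines (nb (flip c i) v j) = {j, k'}"
    using triangle[OF d v' j(2,1)] by metis
  have "k' = k"
    using k' k nb_flip[OF assms(2,3)] by (metis doubleton_eq_iff)
  have jv: "j \<in> lines v"
    using j by simp
  have "card {i, j, k} \<le> 4"
    by (simp add: card_insert_if)
  then obtain e where e: "e \<in> L" "e \<notin> {i, j, k}"
    using not_subset_small[of "{i, j, k}"] by auto
  have "nb c v j = nb (flip c i) v j"
    using nb(1)[OF assms(2) jv] nb(1)[OF v' jv] k(5) k'(3) \<open>k' = k\<close> e
    by (intro same_lines_inc[of _ c _ "flip c i" e]) (auto simp: in_flip_iff)
  then have "i \<in> lines (nb c v j)"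
    using inc_differ[OF nb(1)[OF assms(2) jv], of "flip c i" i] nb(1)[OF v' jv] assms(3) lines_subset
    by (metis in_flip_iff subsetD)
  then show False
    using k j by simp
qed

text \<open>The sides lie on \<open>i\<close>, \<open>m\<close>, \<open>k\<close>, \<open>l\<close>
  in cyclic order. Triangles across \<open>l\<close> and \<open>m\<close> would both have their apex
  where \<open>i\<close> meets \<open>k\<close>, and a fifth line shows that the apexes are equal.
  This point is on both sides of \<open>l\<close>, so a third line would pass through it.\<close>

lemma no_opposite_triangles:
  assumes "deg c = 4" "inc v c" "lines v = {i, l}" "i \<noteq> l" "lines (nb c v i) = {i, m}"
  shows "deg (flip c l) \<noteq> 3 \<or> deg (flip c m) \<noteq> 3"
proof (rule ccontr)
  assume "\<not> ?thesis"
  then have d: "deg (flip c l) = 3" "deg (flip c m) = 3"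
    by auto
  obtain k e where q: "k \<in> L" "k \<noteq> i" "k \<noteq> l" "k \<noteq> m" "m \<noteq> i" "m \<noteq> l" "m \<in> L"
    "lines (nb c v l) = {l, k}" "lines e = {m, k}" "inc e c"
    using quadrilateral[OF assms] by metis
  have il: "i \<in> lines v" "l \<in> lines v"
    using assms(3) by auto
  define a where "a = nb c v i"
  have a: "inc a c" "lines a = {i, m}" "m \<in> lines a" "i \<in> lines a"
    using nb(1)[OF assms(2) il(1)] assms(5) by (auto simp: a_def)
  have "e \<noteq> a"
    using a(2) q(2,4,9) by (metis doubleton_eq_iff)
  then have e: "e = nb c a m"
    using nb_eqI[OF a(1,3) q(10)] q(9) by simp
  have v': "inc v (flip c l)" and a': "inc a (flip c m)"
    using inc_flip[OF assms(2) il(2)] inc_flip[OF a(1,3)] by auto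
  obtain k1 where k1: "lines (nb (flip c l) v i) = {i, k1}" "lines (nb (flip c l) v l) = {l, k1}" "k1 \<noteq> l"
    using triangle[OF d(1) v' assms(3,4)] by metis
  have "k1 = k"
    using k1(2,3) q(8) nb_flip[OF assms(2) il(2)] by (metis doubleton_eq_iff)
  obtain k2 where k2: "lines (nb (flip c m) a i) = {i, k2}" "lines (nb (flip c m) a m) = {m, k2}" "k2 \<noteq> m"
    using triangle[OF d(2) a' a(2)] q(5) by metis
  have "k2 = k"
    using k2(2,3) q(4,9) nb_flip[OF a(1,3)] e by (metis doubleton_eq_iff)
  define s t where "s = nb (flip c l) v i" and "t = nb (flip c m) a i"
  have s: "inc s (flip c l)" "lines s = {i, k}" and t: "inc t (flip c m)" "lines t = {i, k}"
    using nb(1)[OF v' il(1)] nb(1)[OF a' a(4)] k1(1) k2(1) \<open>k1 = k\<close> \<open>k2 = k\<close> by (auto simp: s_def t_def)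
  have "card {i, k, l, m} \<le> 4"
    by (simp add: card_insert_if)
  then obtain f where f: "f \<in> L" "f \<notin> {i, k, l, m}"
    using not_subset_small[of "{i, k, l, m}"] by auto
  have "s = t"
    using s t f by (intro same_lines_inc[of _ "flip c l" _ "flip c m" f]) (auto simp: in_flip_iff)
  moreover have "l \<in> L"
    using il(2) lines_subset by blast
  ultimately have "l \<in> lines s"
    using inc_differ[OF s(1), of "flip c m" l] t(1) q(6) by (metis in_flip_iff)
  then show False
    using s(2) assms(4) q(3) by simp
qed

subsection \<open>Counting cells\<close>

definition cells :: "'l set set" where
  "cells = {c. corners c \<noteq> {}}"

lemma finite_cells: "finite cells"
  using finite_L by (auto simp: cells_def corners_def inc_def intro: finite_subset[of _ "Pow L"])

lemma inc_cells: "inc v c \<Longrightarrow> c \<in> cells"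
  by (auto simp: cells_def corners_def)

section \<open>The four cells at a vertex, and double counting\<close>

lemma finite_cells_at: "finite {c. inc v c}"
  using finite_cells inc_cells by (metis finite_subset mem_Collect_eq subsetI)

lemma ex_inc: "v \<in> verts \<Longrightarrow> inc v {l \<in> L. 0 < N l \<bullet> v}"
  by (auto simp: inc_def)

text \<open>Two cells with corner \<open>v\<close> can differ only in the lines through
  \<open>v\<close>.\<close>

lemma cells_at_eq:
  assumes "inc v c" "lines v = {i, j}" "i \<noteq> j"
  shows "{c'. inc v c'} = {c, flip c i, flip c j, flip (flip c i) j}"
proof (intro equalityI subsetI)
  fix c' assume "c' \<in> {c'. inc v c'}"
  then have c': "inc v c'"
    by simp
  have "l \<in> c' \<longleftrightarrow> l \<in> c" if "l \<noteq> i" "l \<noteq> j" for l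
  proof (cases "l \<in> L")
    case True
    then show ?thesis
      using inc_differ[OF assms(1) c' True] assms(2) that by auto
  next
    case False
    then show ?thesis
      using assms(1) c' by (auto simp: inc_def)
  qed
  then show "c' \<in> {c, flip c i, flip c j, flip (flip c i) j}"
    using assms(3)
    by (cases "i \<in> c' \<longleftrightarrow> i \<in> c"; cases "j \<in> c' \<longleftrightarrow> j \<in> c")
      (simp_all add: set_eq_iff in_flip_iff, metis+)
next
  fix c' assume "c' \<in> {c, flip c i, flip c j, flip (flip c i) j}"
  then show "c' \<in> {c'. inc v c'}"
    using assms(1,2) inc_flip_iff by auto
qed

lemma sum_cells_at:
  assumes "inc v c" "lines v = {i, j}" "i \<noteq> j"
  shows "(\<Sum>c' | inc v c'. h c') = h c + h (flip c i) + h (flip c j) + h (flip (flip c i) j)"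
proof -
  have "flip (flip c i) j \<noteq> c"
    using assms(3) by (metis flip_eq_iff flip_flip)
  moreover have "flip (flip c i) j \<noteq> flip c j"
    by (metis flip_commute flip_neq)
  ultimately show ?thesis
    unfolding cells_at_eq[OF assms] using assms(3) by (auto simp: add_ac flip_neq[symmetric] dest: sym)
qed

lemma sum_incidences:
  "(\<Sum>c\<in>cells. \<Sum>v\<in>corners c. h c v) = (\<Sum>v\<in>verts. \<Sum>c | inc v c. h c v)"
proof -
  have "(\<Sum>c\<in>cells. \<Sum>v\<in>corners c. h c v) = (\<Sum>c\<in>cells. \<Sum>v | v \<in> verts \<and> inc v c. h c v)"
    by (rule sum.cong) (auto simp: corners_def inc_verts intro!: sum.cong)
  also have "\<dots> = (\<Sum>v\<in>verts. \<Sum>c | c \<in> cells \<and> inc v c. h c v)"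
    by (rule sum.swap_restrict[OF finite_cells finite_verts])
  also have "\<dots> = (\<Sum>v\<in>verts. \<Sum>c | inc v c. h c v)"
    by (intro sum.cong refl) (auto simp: inc_cells)
  finally show ?thesis .
qed

lemma sum_deg: "(\<Sum>c\<in>cells. deg c) = 4 * card verts"
proof -
  have "(\<Sum>c\<in>cells. deg c) = (\<Sum>c\<in>cells. \<Sum>v\<in>corners c. 1)"
    by (simp add: deg_def)
  also have "\<dots> = (\<Sum>v\<in>verts. \<Sum>c | inc v c. 1)"
    by (rule sum_incidences)
  also have "\<dots> = (\<Sum>v\<in>verts. 4)"
  proof (rule sum.cong)
    fix v assume v: "v \<in> verts"
    obtain i j where "i \<noteq> j" "lines v = {i, j}"
      using v by (elim vertsE) blast
    then show "(\<Sum>c | inc v c. 1) = (4::nat)"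
      using sum_cells_at[OF ex_inc[OF v], of i j "\<lambda>_. 1::nat"] by simp
  qed simp
  finally show ?thesis by simp
qed

text \<open>One order of the two lines makes \<open>v\<close> a positive multiple of the cross
  product, and this order selects one of the four cells at \<open>v\<close>: the one in which
  \<open>v\<close> precedes all other corners in the sweep.\<close>

definition first :: "real^3 \<Rightarrow> 'l set \<Rightarrow> bool" where
  "first v c \<longleftrightarrow> inc v c \<and> (\<exists>i j k. lines v = {i, j} \<and> i \<noteq> j \<and> i \<in> c \<and> j \<notin> c \<and> 0 < k \<and>
     v = k *\<^sub>R cross3 (N i) (N j))"

lemma ex_first:
  assumes "v \<in> verts"
  shows "\<exists>c. first v c"
proof -
  have "\<exists>i j k. lines v = {i, j} \<and> i \<noteq> j \<and> 0 < k \<and> v = k *\<^sub>R cross3 (N i) (N j)"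
  proof -
    obtain i j where ij: "i \<noteq> j" "lines v = {i, j}"
      using assms by (elim vertsE) blast
    obtain k where k: "v = k *\<^sub>R cross3 (N i) (N j)" "k \<noteq> 0"
      using lines_cross[OF assms ij(2,1)] by blast
    show ?thesis
    proof (cases "0 < k")
      case False
      have "v = (- k) *\<^sub>R cross3 (N j) (N i)"
        using k(1) cross_skew[of "N i" "N j"] by simp
      moreover have "lines v = {j, i}"
        using ij(2) by auto
      ultimately show ?thesis
        using False k(2) ij(1) by (metis linorder_cases neg_0_less_iff_less)
    qed (use ij k in blast)
  qed
  then obtain i j k where ijk: "lines v = {i, j}" "i \<noteq> j" "0 < k" "v = k *\<^sub>R cross3 (N i) (N j)"
    by blast
  \<comment> \<open>Neither line through \<open>v\<close> belongs to the set on the right, so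
    \<open>c\<close> is on the positive side of \<open>i\<close> and the negative side of
    \<open>j\<close>.\<close>
  define c where "c = insert i {l \<in> L. 0 < N l \<bullet> v}"
  have "i \<in> lines v" "j \<in> lines v"
    using ijk(1) by auto
  then have "N i \<bullet> v = 0" "N j \<bullet> v = 0" "i \<in> L"
    by (auto simp: lines_def)
  then have "inc v c" "i \<in> c" "j \<notin> c"
    using assms ijk(2) by (auto simp: c_def inc_def)
  then show ?thesis
    using ijk by (auto simp: first_def)
qed

text \<open>The determinant of \<open>x\<close>, \<open>v\<close>, \<open>w\<close> is positive when \<open>v\<close> is the first vertex of the cell that a half
  circle rotating about the pole \<open>x\<close> meets.\<close>

lemma first_det:
  assumes pole: "\<And>l. l \<in> L \<Longrightarrow> 0 < N l \<bullet> x"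
    and "first v c" "inc w c" "w \<noteq> v"
  shows "0 < x \<bullet> cross3 v w"
proof -
  obtain i j k where ijk: "lines v = {i, j}" "i \<noteq> j" "i \<in> c" "j \<notin> c" "0 < k"
      "v = k *\<^sub>R cross3 (N i) (N j)" and v: "inc v c"
    using assms(2) by (auto simp: first_def)
  have ij: "i \<in> lines v" "j \<in> lines v"
    using ijk(1) by auto
  have L: "i \<in> L" "j \<in> L"
    using ij lines_subset by auto
  have w: "0 \<le> N i \<bullet> w" "N j \<bullet> w \<le> 0"
    using assms(3) ijk(3,4) L by (auto simp: inc_def)
  have "\<not> (N i \<bullet> w = 0 \<and> N j \<bullet> w = 0)"
  proof
    assume "N i \<bullet> w = 0 \<and> N j \<bullet> w = 0"
    then have "i \<in> lines w" "j \<in> lines w"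
      using L by (auto simp: lines_def)
    then show False
      using same_cell_eqI[OF v assms(3) ij] ijk(2) assms(4) by metis
  qed
  then have "0 < N i \<bullet> w \<or> N j \<bullet> w < 0"
    using w by linarith
  moreover have "0 \<le> (N j \<bullet> x) * (N i \<bullet> w)" "0 \<le> (N i \<bullet> x) * - (N j \<bullet> w)"
    using mult_nonneg_nonneg[of "N j \<bullet> x" "N i \<bullet> w"] mult_nonneg_nonneg[of "N i \<bullet> x" "- (N j \<bullet> w)"]
      pole[OF L(1)] pole[OF L(2)] w by linarith+
  moreover have "0 < N i \<bullet> w \<Longrightarrow> 0 < (N j \<bullet> x) * (N i \<bullet> w)"
    "N j \<bullet> w < 0 \<Longrightarrow> 0 < (N i \<bullet> x) * - (N j \<bullet> w)"
    using mult_pos_pos[of "N j \<bullet> x" "N i \<bullet> w"] mult_pos_pos[of "N i \<bullet> x" "- (N j \<bullet> w)"]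
      pole[OF L(1)] pole[OF L(2)] by linarith+
  ultimately have "0 < (N j \<bullet> x) * (N i \<bullet> w) + (N i \<bullet> x) * - (N j \<bullet> w)"
    by linarith
  \<comment> \<open>Expansion of the triple product. Both summands are nonnegative, and one is
    positive because \<open>w\<close> is not on both lines.\<close>
  moreover have "x \<bullet> cross3 v w = k * ((N j \<bullet> x) * (N i \<bullet> w) + (N i \<bullet> x) * - (N j \<bullet> w))"
    unfolding ijk(6) by (simp add: cross3_simps)
  ultimately show ?thesis
    using ijk(5) by simp
qed

text \<open>The determinant changes sign when \<open>v\<close> and \<open>w\<close> are exchanged,
  so no cell has two first vertices. A cell with a first vertex is on the negative side of some
  line, so the cell \<open>L\<close> around the pole is missed.\<close>

lemma card_verts_less_cells:
  assumes pole: "\<And>l. l \<in> L \<Longrightarrow> 0 < N l \<bullet> x" and "inc u L"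
  shows "card verts < card cells"
proof -
  obtain \<phi> where \<phi>: "\<And>v. v \<in> verts \<Longrightarrow> first v (\<phi> v)"
    using ex_first by metis
  have "inj_on \<phi> verts"
  proof (rule inj_onI, rule ccontr)
    fix v w assume vw: "v \<in> verts" "w \<in> verts" "\<phi> v = \<phi> w" "v \<noteq> w"
    then have f: "first v (\<phi> v)" "first w (\<phi> v)"
      using \<phi> by metis+
    then have "inc v (\<phi> v)" "inc w (\<phi> v)"
      by (auto simp: first_def)
    then have "0 < x \<bullet> cross3 v w" "0 < x \<bullet> cross3 w v"
      using first_det[OF pole f(1)] first_det[OF pole f(2)] vw(4) by metis+
    then show False
      using cross_skew[of v w] by simp
  qed
  moreover have "\<phi> ` verts \<subseteq> cells - {L}"
  proof
    fix c assume "c \<in> \<phi> ` verts"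
    then obtain v where "first v c"
      using \<phi> by auto
    then obtain j where "inc v c" "j \<in> lines v" "j \<notin> c"
      by (auto simp: first_def)
    then show "c \<in> cells - {L}"
      using inc_cells lines_subset by blast
  qed
  ultimately have "card verts \<le> card (cells - {L})"
    using finite_cells card_inj_on_le by blast
  also have "\<dots> < card cells"
    using finite_cells inc_cells[OF assms(2)] by (intro psubset_card_mono) auto
  finally show ?thesis .
qed

end

subsection \<open>Discharging\<close>

text \<open>The charge that a face of degree \<open>f\<close> gives to one of its vertices, where \<open>p\<close>, \<open>q\<close> are the degrees
  of the faces adjacent to it there and \<open>r\<close> is the degree of the opposite face.\<close>

definition weight :: "nat \<Rightarrow> nat \<Rightarrow> nat \<Rightarrow> nat \<Rightarrow> real" where
  "weight f p q r =
    (if f \<le> 4 then 0 else if f = 5 then 1/5 else if f = 6 then 1/3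
     else if f = 7 then (if p = 4 \<and> q = 4 \<and> r = 3 then 1/2 else if p = 3 \<and> q = 3 then 2/5 else 1/3)
     else 1/2)"

text \<open>What a triangle receives at a corner: \<open>x\<close>, \<open>y\<close> are the degrees
  of the adjacent faces and \<open>r\<close> that of the opposite face. If the latter is a triangle
  too, the two share equally.\<close>

definition gain :: "nat \<Rightarrow> nat \<Rightarrow> nat \<Rightarrow> real" where
  "gain x y r = (if r = 3 then 1/2 else 1) * (weight x 3 r y + weight y r 3 x + weight r y x 3)"

text \<open>Minimum of \<open>gain x y r\<close> over the admissible \<open>r\<close>: since \<open>x + y + r \<ge> 15\<close>, the opposite face can be a
  triangle only in the first case. As \<open>weight\<close> is constant from 8 on, \<open>x\<close> and \<open>y\<close> may be cut off at 8.\<close>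

definition gain_bound :: "nat \<Rightarrow> nat \<Rightarrow> real" where
  "gain_bound x y =
    (if 12 \<le> x + y then weight x 3 3 y / 2 + weight y 3 3 x / 2
     else weight x 0 0 0 + weight y 0 0 0 +
       (if x + y = 8 then 1/2 else if x + y = 9 then 1/3 else if x + y = 10 then 1/5 else 0))"

section \<open>Arithmetic of the weights\<close>

lemma nat_4_to_8: "4 \<le> x \<Longrightarrow> x = 4 \<or> x = 5 \<or> x = 6 \<or> x = 7 \<or> 8 \<le> x" for x :: nat
  by presburger

text \<open>For \<open>x + y\<close> equal to 8, 9, 10 the opposite face has degree at least 7, 6, 5
  and gives at least 1/2, 1/3, 1/5. The 1/2 for a heptagon is its special value, opposite a triangle
  and between two quadrilaterals.\<close>

lemma gain_bound_le:
  assumes "4 \<le> x" "4 \<le> y" "3 \<le> r" "15 \<le> x + y + r"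
  shows "gain_bound (min x 8) (min y 8) \<le> gain x y r"
proof -
  have "r = 3 \<or> r = 4 \<or> r = 5 \<or> r = 6 \<or> r = 7 \<or> 8 \<le> r"
    using assms(3) by presburger
  then show ?thesis
    using nat_4_to_8[OF assms(1)] nat_4_to_8[OF assms(2)] assms(4)
    by (elim disjE) (simp_all add: gain_bound_def gain_def weight_def)
qed

text \<open>A finite check, with equality for example at (4,4,8), (4,8,8), (5,7,7) and (6,6,6). With
  1/3 instead of the heptagon values 1/2 and 2/5, the first and the third would fail.\<close>

lemma gain_bound_sum:
  assumes "x \<in> {4,5,6,7,8}" "y \<in> {4,5,6,7,8}" "z \<in> {4,5,6,7,8}"
  shows "1 \<le> gain_bound x y + gain_bound x z + gain_bound y z"
  using assms unfolding insert_iff empty_iff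
  by (elim disjE) (simp_all add: gain_bound_def weight_def)

text \<open>Here \<open>x\<close>, \<open>y\<close>, \<open>z\<close> belong to the faces across the
  sides of a triangle and \<open>p\<close>, \<open>q\<close>, \<open>r\<close> to the faces opposite
  it at the corners. The 15 is 18 less the degree of the triangle.\<close>

lemma gain_sum:
  assumes "4 \<le> x" "4 \<le> y" "4 \<le> z" "3 \<le> p" "3 \<le> q" "3 \<le> r"
    "15 \<le> x + y + p" "15 \<le> x + z + q" "15 \<le> y + z + r"
  shows "1 \<le> gain x y p + gain x z q + gain y z r"
proof -
  have "min n 8 \<in> {4,5,6,7,8}" if "4 \<le> n" for n :: nat
    using nat_4_to_8[OF that] by auto
  then have "1 \<le> gain_bound (min x 8) (min y 8) + gain_bound (min x 8) (min z 8) +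
      gain_bound (min y 8) (min z 8)"
    using assms by (intro gain_bound_sum) blast+
  also have "\<dots> \<le> gain x y p + gain x z q + gain y z r"
    using assms by (intro add_mono gain_bound_le)
  finally show ?thesis .
qed

section \<open>Charges and receipts in an arrangement\<close>

context line_arrangement
begin

text \<open>Quantifying over the lines through \<open>v\<close> avoids choosing an order of them;
  \<open>charge_eq\<close> gives the form with \<open>weight\<close>.\<close>

definition charge :: "'l set \<Rightarrow> real^3 \<Rightarrow> real" where
  "charge c v =
    (if deg c \<le> 4 then 0 else if deg c = 5 then 1/5 else if deg c = 6 then 1/3
     else if deg c = 7 then
       (if \<forall>i\<in>lines v. deg (flip c i) = 4 \<and> (\<forall>j\<in>lines v. i \<noteq> j \<longrightarrow> deg (flip (flip c i) j) = 3)
        then 1/2 else if \<forall>i\<in>lines v. deg (flip c i) = 3 then 2/5 else 1/3)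
     else 1/2)"

lemma charge_eq:
  assumes "lines v = {i, j}" "i \<noteq> j"
  shows "charge c v = weight (deg c) (deg (flip c i)) (deg (flip c j)) (deg (flip (flip c i) j))"
  using assms by (auto simp: charge_def weight_def flip_commute[of c j i])

lemma charge_nonneg: "0 \<le> charge c v"
  by (simp add: charge_def)

text \<open>Charge 1/2 at both ends would put triangles on opposite sides of the quadrilateral
  across the edge. Charges 1/2 and 2/5 ask for different degrees of that face. The largest remaining
  sum is 1/2 + 1/3.\<close>

lemma charge_edge:
  assumes "inc v c" "i \<in> lines v" "deg c = 7"
  shows "charge c v + charge c (nb c v i) \<le> 6/7"
proof -
  obtain l where l: "i \<noteq> l" "lines v = {i, l}"
    using lines_other[OF inc_verts[OF assms(1)] assms(2)] by metis
  note b = nb[OF assms(1,2)]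
  obtain m where m: "i \<noteq> m" "lines (nb c v i) = {i, m}"
    using lines_other[OF inc_verts[OF b(1)] b(2)] by metis
  have "\<not> (deg (flip c i) = 4 \<and> deg (flip (flip c i) l) = 3 \<and> deg (flip (flip c i) m) = 3)"
    using no_opposite_triangles[of "flip c i" v i l m] inc_flip[OF assms(1,2)] l m nb_flip[OF assms(1,2)]
    by auto
  then show ?thesis
    unfolding charge_eq[OF l(2,1)] charge_eq[OF m(2,1)] weight_def using assms(3) by auto
qed

text \<open>Summation over pairs of a corner and a line through it counts each corner twice.\<close>

lemma sum_corners_edge_bound:
  fixes h :: "real^3 \<Rightarrow> real"
  assumes "\<And>v i. inc v c \<Longrightarrow> i \<in> lines v \<Longrightarrow> h v + h (nb c v i) \<le> B"
  shows "2 * (\<Sum>v\<in>corners c. h v) \<le> B * deg c"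
proof -
  let ?F = "Sigma (corners c) lines"
  have fin: "finite (corners c)" "\<forall>v\<in>corners c. finite (lines v)"
    using finite_corners finite_lines by auto
  have card: "v \<in> corners c \<Longrightarrow> card (lines v) = 2" for v
    using card_lines inc_verts corners_iff by blast
  have 1: "(\<Sum>(v, i)\<in>?F. h v) = 2 * (\<Sum>v\<in>corners c. h v)"
    unfolding sum.Sigma[OF fin, symmetric] by (simp add: card sum_distrib_left)
  \<comment> \<open>Passing to the other end of the edge is an involution of these pairs.\<close>
  have 2: "(\<Sum>(v, i)\<in>?F. h (nb c v i)) = (\<Sum>(v, i)\<in>?F. h v)"
    by (rule sum.reindex_bij_witness[of _ "\<lambda>(v, i). (nb c v i, i)" "\<lambda>(v, i). (nb c v i, i)"])
      (auto simp: corners_iff nb nb_nb)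
  have "(\<Sum>(v, i)\<in>?F. h v + h (nb c v i)) \<le> (\<Sum>(v, i)\<in>?F. B)"
    by (rule sum_mono) (auto simp: corners_iff assms)
  also have "\<dots> = 2 * B * deg c"
    unfolding sum.Sigma[OF fin, symmetric] by (simp add: card deg_def)
  finally show ?thesis
    using 1 2 by (simp add: case_prod_beta sum.distrib)
qed

text \<open>The added 1 makes the bound 0 for triangles, which give nothing. Degrees 5 and 6 give
  exactly 1 and 2, and for heptagons the edge bound 6/7 yields 3.\<close>

lemma sum_charge_cell:
  assumes "c \<in> cells"
  shows "(\<Sum>v\<in>corners c. charge c v) \<le> real (deg c) - 4 + (if deg c = 3 then 1 else 0)"
proof -
  have ge: "3 \<le> deg c"
    using assms deg_ge_3 by (auto simp: cells_def corners_def)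
  consider "deg c \<le> 4" | "deg c = 5" | "deg c = 6" | "deg c = 7" | "8 \<le> deg c"
    by linarith
  then show ?thesis
  proof cases
    case 4
    then show ?thesis
      using sum_corners_edge_bound[of c "charge c" "6/7"] charge_edge by simp
  next
    case 5
    then have "(\<Sum>v\<in>corners c. charge c v) = real (deg c) / 2"
      by (simp add: charge_def deg_def)
    then show ?thesis
      using 5 by simp
  qed (use ge in \<open>auto simp: charge_def deg_def\<close>)
qed

text \<open>For a triangle \<open>c\<close>: the whole charge given at \<open>v\<close>, halved if
  the opposite face is also a triangle.\<close>

definition receipt :: "'l set \<Rightarrow> real^3 \<Rightarrow> real" where
  "receipt c v =
    (if \<forall>i\<in>lines v. \<forall>j\<in>lines v. i \<noteq> j \<longrightarrow> deg (flip (flip c i) j) = 3 then 1/2 else 1) *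
    (\<Sum>c' | inc v c'. charge c' v)"

lemma receipt_eq:
  assumes "inc v c" "lines v = {i, j}" "i \<noteq> j"
  shows "receipt c v =
    (if deg (flip (flip c i) j) = 3 then 1/2 else 1) * (\<Sum>c' | inc v c'. charge c' v)"
  using assms(2,3) by (auto simp: receipt_def flip_commute[of c j i])

lemma receipt_gain:
  assumes "inc v c" "lines v = {i, j}" "i \<noteq> j" "deg c = 3"
  shows "receipt c v = gain (deg (flip c i)) (deg (flip c j)) (deg (flip (flip c i) j))"
proof -
  have "charge c v = 0"
    using assms(4) by (simp add: charge_def)
  then show ?thesis
    unfolding receipt_eq[OF assms(1-3)] gain_def sum_cells_at[OF assms(1-3)] charge_eq[OF assms(2,3)]
    using assms(4) by (simp add: flip_commute[of c j i] flip_commute[of "flip c i" j i])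
qed

text \<open>As triangles are never adjacent, at most two meet at \<open>v\<close>; two are opposite,
  and each takes half.\<close>

lemma sum_receipt_vertex:
  assumes "v \<in> verts"
  shows "(\<Sum>c | inc v c. if deg c = 3 then receipt c v else 0) \<le> (\<Sum>c | inc v c. charge c v)"
proof -
  obtain i j where ij: "i \<noteq> j" "lines v = {i, j}"
    using assms by (elim vertsE) blast
  have iv: "i \<in> lines v" "j \<in> lines v"
    using ij by auto
  define c where "c = {l \<in> L. 0 < N l \<bullet> v}"
  have c: "inc v c"
    unfolding c_def by (rule ex_inc[OF assms])
  let ?R = "\<Sum>c | inc v c. charge c v"
  have R: "0 \<le> ?R"
    by (intro sum_nonneg charge_nonneg)
  note adj = no_adjacent_triangles
  have ci: "inc v (flip c i)" and cj: "inc v (flip c j)" and cij: "inc v (flip (flip c i) j)"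
    using inc_flip c iv by blast+
  have 1: "deg c = 3 \<Longrightarrow> deg (flip c i) \<noteq> 3 \<and> deg (flip c j) \<noteq> 3"
    using adj[OF _ c iv(1)] adj[OF _ c iv(2)] by blast
  have 2: "deg (flip (flip c i) j) = 3 \<Longrightarrow> deg (flip c i) \<noteq> 3 \<and> deg (flip c j) \<noteq> 3"
    using adj[OF _ cij iv(1)] adj[OF _ cij iv(2)] by (simp add: flip_commute[of "flip c i" j i])
  show ?thesis
    unfolding sum_cells_at[OF c ij(2,1), of "\<lambda>c. if deg c = 3 then receipt c v else 0"]
      receipt_eq[OF c ij(2,1)] receipt_eq[OF ci ij(2,1)] receipt_eq[OF cj ij(2,1)] receipt_eq[OF cij ij(2,1)]
    using 1 2 R by (auto simp: flip_commute[of c j i] flip_commute[of "flip c i" j i])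
qed

lemma sum_receipt_triangle:
  assumes big: "\<And>v. v \<in> verts \<Longrightarrow> 18 \<le> (\<Sum>c | inc v c. deg c)"
    and "c \<in> cells" "deg c = 3"
  shows "1 \<le> (\<Sum>v\<in>corners c. receipt c v)"
proof -
  obtain v where v: "inc v c"
    using assms(2) by (auto simp: cells_def corners_def)
  obtain i j where ij: "i \<noteq> j" "lines v = {i, j}"
    using inc_verts[OF v] by (elim vertsE) blast
  have iv: "i \<in> lines v" "j \<in> lines v"
    using ij by auto
  define a b where "a = nb c v i" and "b = nb c v j"
  obtain k where k: "k \<noteq> i" "k \<noteq> j" "lines a = {i, k}" "lines b = {j, k}" "corners c = {v, a, b}"
    unfolding a_def b_def using triangle[OF assms(3) v ij(2,1)] by metis
  have a: "inc a c" "a \<noteq> v" and b: "inc b c" "b \<noteq> v" and ab: "a \<noteq> b"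
    using nb(1,3)[OF v iv(1)] nb(1,3)[OF v iv(2)] nb_distinct[OF v iv ij(1)] by (auto simp: a_def b_def)
  have ge4: "4 \<le> deg (flip c l)" if "inc w c" "l \<in> lines w" for w l
    using no_adjacent_triangles[OF assms(3) that] deg_ge_3[OF inc_flip[OF that]] by linarith
  have total: "15 \<le> deg (flip c l) + deg (flip c m) + deg (flip (flip c l) m)"
    "3 \<le> deg (flip (flip c l) m)"
    if w: "inc w c" "lines w = {l, m}" "l \<noteq> m" for w l m
    using big[OF inc_verts[OF w(1)]] sum_cells_at[OF w, of deg] assms(3) w(2)
      deg_ge_3[OF inc_flip[OF inc_flip[OF w(1), of l], of m]] by auto
  have "1 \<le> gain (deg (flip c i)) (deg (flip c j)) (deg (flip (flip c i) j)) +
      gain (deg (flip c i)) (deg (flip c k)) (deg (flip (flip c i) k)) +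
      gain (deg (flip c j)) (deg (flip c k)) (deg (flip (flip c j) k))"
    using ge4[OF v iv(1)] ge4[OF v iv(2)] ge4[OF a(1), of k] total[OF v ij(2,1)]
      total[OF a(1) k(3)] total[OF b(1) k(4)] k by (intro gain_sum) auto
  also have "\<dots> = receipt c v + receipt c a + receipt c b"
    using receipt_gain[OF v ij(2,1) assms(3)] receipt_gain[OF a(1) k(3) _ assms(3)]
      receipt_gain[OF b(1) k(4) _ assms(3)] k(1,2) by simp
  also have "\<dots> = (\<Sum>v\<in>corners c. receipt c v)"
    unfolding k(5) using a(2) b(2) ab by simp
  finally show ?thesis .
qed

lemma ex_small_vertex:
  assumes pole: "\<And>l. l \<in> L \<Longrightarrow> 0 < N l \<bullet> x" and "inc u L"
  shows "\<exists>v\<in>verts. (\<Sum>c | inc v c. deg c) \<le> 17"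
proof (rule ccontr)
  assume neg: "\<not> ?thesis"
  have big: "18 \<le> (\<Sum>c | inc v c. deg c)" if "v \<in> verts" for v
  proof -
    have "\<not> (\<Sum>c | inc v c. deg c) \<le> 17"
      using neg that by blast
    then show ?thesis by linarith
  qed
  have "(\<Sum>c\<in>cells. if deg c = 3 then 1 else (0::real)) \<le>
      (\<Sum>c\<in>cells. \<Sum>v\<in>corners c. if deg c = 3 then receipt c v else 0)"
    using sum_receipt_triangle[OF big] by (intro sum_mono) auto
  also have "\<dots> = (\<Sum>v\<in>verts. \<Sum>c | inc v c. if deg c = 3 then receipt c v else 0)"
    by (rule sum_incidences)
  also have "\<dots> \<le> (\<Sum>v\<in>verts. \<Sum>c | inc v c. charge c v)"
    by (intro sum_mono sum_receipt_vertex)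
  also have "\<dots> = (\<Sum>c\<in>cells. \<Sum>v\<in>corners c. charge c v)"
    by (rule sum_incidences[symmetric])
  also have "\<dots> \<le> (\<Sum>c\<in>cells. real (deg c) - 4 + (if deg c = 3 then 1 else 0))"
    by (intro sum_mono sum_charge_cell)
  also have "\<dots> = real (\<Sum>c\<in>cells. deg c) - 4 * real (card cells) +
      (\<Sum>c\<in>cells. if deg c = 3 then 1 else 0)"
    by (simp add: sum.distrib sum_subtractf)
  \<comment> \<open>The number of triangles cancels from the two ends of the chain, and the degrees
    sum to four times the number of vertices.\<close>
  finally have "card cells \<le> card verts"
    unfolding sum_deg by simp
  then show False
    using card_verts_less_cells[OF pole assms(2)] by simp
qed

text \<open>Each point counted is a corner, off both lines through \<open>v\<close>, of one of the
  four cells at \<open>v\<close>. Every such cell has \<open>deg c - 3\<close> corners of this kind,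
  whence the 12.\<close>

lemma zone_card:
  assumes "v \<in> verts"
  shows "card {w \<in> verts. lines w \<inter> lines v = {} \<and> (\<forall>l\<in>L. 0 \<le> (N l \<bullet> v) * (N l \<bullet> w))} + 12
    \<le> (\<Sum>c | inc v c. deg c)"
proof -
  let ?Z = "{w \<in> verts. lines w \<inter> lines v = {} \<and> (\<forall>l\<in>L. 0 \<le> (N l \<bullet> v) * (N l \<bullet> w))}"
  obtain i j where ij: "i \<noteq> j" "lines v = {i, j}"
    using assms by (elim vertsE) blast
  define R where "R c = {w \<in> corners c. i \<notin> lines w \<and> j \<notin> lines w}" for c
  have deg: "deg c = 3 + card (R c)" if "inc v c" for c
    unfolding R_def by (rule deg_decompose[OF that ij(2,1)])
  have "?Z \<subseteq> (\<Union>c\<in>{c. inc v c}. R c)"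
  proof
    fix w assume w: "w \<in> ?Z"
    \<comment> \<open>The side of \<open>v\<close> for lines missing \<open>v\<close>, and the side
      of \<open>w\<close> for the two lines through \<open>v\<close>.\<close>
    define c where "c = {l \<in> L. 0 < N l \<bullet> v \<or> N l \<bullet> v = 0 \<and> 0 < N l \<bullet> w}"
    have "inc v c"
      using assms by (auto simp: inc_def c_def)
    moreover have "inc w c"
      using w unfolding inc_def c_def by (auto simp: zero_le_mult_iff not_less)
    ultimately show "w \<in> (\<Union>c\<in>{c. inc v c}. R c)"
      using w ij(2) by (auto simp: R_def corners_iff)
  qed
  then have "card ?Z \<le> card (\<Union>c\<in>{c. inc v c}. R c)"
    using finite_cells_at finite_corners by (intro card_mono finite_UN_I) (auto simp: R_def)
  also have "\<dots> \<le> (\<Sum>c | inc v c. card (R c))"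
    by (rule card_UN_le[OF finite_cells_at])
  finally have "card ?Z + (\<Sum>c | inc v c. 3) \<le> (\<Sum>c | inc v c. 3 + card (R c))"
    by (simp add: sum.distrib)
  moreover have "(\<Sum>c | inc v c. 3) = (12::nat)"
    using sum_cells_at[OF ex_inc[OF assms] ij(2,1), of "\<lambda>_. 3::nat"] by simp
  ultimately show ?thesis
    using deg by simp
qed

end

subsection \<open>Faces on the sphere\<close>

text \<open>A connected face with points strictly on both sides would meet the line; the closed
  condition then passes to the closure.\<close>

lemma closure_face_same_side:
  assumes "l \<in> L" "l = {x \<in> S2. a \<bullet> x = 0}" "v \<in> S2 - \<Union>L" "w \<in> closure (face_at L v)"
  shows "0 \<le> (a \<bullet> v) * (a \<bullet> w)"
proof -
  have "0 \<le> (a \<bullet> v) * (a \<bullet> y)" if y: "y \<in> face_at L v" for y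
  proof (rule ccontr)
    assume neg: "\<not> ?thesis"
    have conn: "connected (face_at L v)" and v: "v \<in> face_at L v" and sub: "face_at L v \<subseteq> S2 - \<Union>L"
      using assms(3) by (simp_all add: face_at_def connected_component_subset connected_connected_component)
    have "\<exists>z\<in>face_at L v. a \<bullet> z = 0"
    proof (cases "a \<bullet> v \<le> 0")
      case True
      then show ?thesis
        using neg connected_ivt_hyperplane[OF conn v y, of a 0] by (simp add: zero_le_mult_iff)
    next
      case False
      then show ?thesis
        using neg connected_ivt_hyperplane[OF conn y v, of a 0] by (simp add: zero_le_mult_iff)
    qed
    then show False
      using sub assms(1,2) by blast
  qed
  then have "face_at L v \<subseteq> {y. 0 \<le> (a \<bullet> v) * (a \<bullet> y)}"
    by blast
  moreover have "closed {y. 0 \<le> (a \<bullet> v) * (a \<bullet> y)}"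
    by (intro closed_Collect_le continuous_intros)
  ultimately show ?thesis
    using closure_minimal assms(4) by blast
qed

theorem theorem1:
  fixes L :: "(real^3) set set"
  assumes "finite L" and "card L \<ge> 2"
    and "\<forall>l\<in>L. is_proj_line l"
    and "general_position L"
  shows "C L \<le> 5"
proof -
  obtain a where a: "\<And>l. l \<in> L \<Longrightarrow> a l \<noteq> 0" "\<And>l. l \<in> L \<Longrightarrow> l = {x \<in> S2. a l \<bullet> x = 0}"
    using assms(3) unfolding is_proj_line_def by metis
  \<comment> \<open>Stated for arbitrary normals, to cover both the given ones and those turned
    towards the pole.\<close>
  have circles: "great_circles L N"
    if N: "\<And>l. l \<in> L \<Longrightarrow> N l \<noteq> 0" "\<And>l. l \<in> L \<Longrightarrow> l = {x \<in> S2. N l \<bullet> x = 0}" for N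
  proof
    show "finite L" by fact
    fix l m assume lm: "l \<in> L" "m \<in> L" "l \<noteq> m"
    show "cross3 (N l) (N m) \<noteq> 0"
    proof
      assume 0: "cross3 (N l) (N m) = 0"
      \<comment> \<open>Lagrange's formula writes the vanishing cross product of \<open>x\<close>
        with \<open>cross3 (N l) (N m)\<close> as a combination of the two normals.\<close>
      have "N l \<bullet> x = 0 \<longleftrightarrow> N m \<bullet> x = 0" for x
        using Lagrange[of x "N l" "N m"] N(1) lm(1,2) unfolding 0 by (auto simp: inner_commute)
      then show False
        using N(2)[OF lm(1)] N(2)[OF lm(2)] lm(3) by auto
    qed
  next
    fix k l m x assume *: "k \<in> L" "l \<in> L" "m \<in> L" "k \<noteq> l" "k \<noteq> m" "l \<noteq> m"
      "N k \<bullet> x = 0" "N l \<bullet> x = 0" "N m \<bullet> x = 0"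
    show "x = 0"
    proof (rule ccontr)
      assume "x \<noteq> 0"
      then have S: "x /\<^sub>R norm x \<in> S2"
        by (simp add: S2_def)
      have "x /\<^sub>R norm x \<in> k" "x /\<^sub>R norm x \<in> l" "x /\<^sub>R norm x \<in> m"
        using S * by (subst N(2), simp, simp)+
      then show False
        using assms(4) *(1-6) unfolding general_position_def by blast
    qed
  qed
  have arr: "arr_vertices M = great_circles.verts M N"
    if "M \<subseteq> L" and N: "\<And>l. l \<in> L \<Longrightarrow> N l \<noteq> 0" "\<And>l. l \<in> L \<Longrightarrow> l = {x \<in> S2. N l \<bullet> x = 0}" for M N
  proof -
    have mem: "x \<in> l \<longleftrightarrow> norm x = 1 \<and> N l \<bullet> x = 0" if "l \<in> M" for l x
      using N(2)[of l] \<open>M \<subseteq> L\<close> that by (auto simp: S2_def)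
    interpret M: great_circles M N
      by (rule great_circles.great_circles_subset[OF circles[OF N] that(1)])
    show ?thesis
    proof (intro equalityI subsetI)
      fix x assume "x \<in> arr_vertices M"
      then obtain l m where "l \<in> M" "m \<in> M" "l \<noteq> m" "x \<in> l" "x \<in> m"
        unfolding arr_vertices_def by blast
      then show "x \<in> M.verts"
        unfolding M.verts_def using mem[of l x] mem[of m x] by blast
    next
      fix x assume "x \<in> M.verts"
      then obtain l m where "l \<in> M" "m \<in> M" "l \<noteq> m" "norm x = 1" "N l \<bullet> x = 0" "N m \<bullet> x = 0"
        unfolding M.verts_def by blast
      then show "x \<in> arr_vertices M"
        unfolding arr_vertices_def using mem[of l x] mem[of m x] by blast
    qed
  qed
  interpret A: great_circles L a
    using circles a by blast
  have min: "C L \<le> 5" if "v \<in> arr_vertices L" "zone_complexity L v \<le> 5" for v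
  proof -
    have "C L \<le> zone_complexity L v"
      unfolding C_def using that(1) A.finite_verts arr[of L a] a by (intro Min_le) auto
    then show ?thesis
      using that(2) by simp
  qed
  obtain u where u: "u \<in> A.verts"
    using A.ex_vertex[OF assms(2)] by blast
  have mem_a: "u \<in> l \<longleftrightarrow> l \<in> A.lines u" if "l \<in> L" for l
    using a(2)[OF that] that A.verts_norm[OF u] by (auto simp: S2_def A.lines_def)
  show ?thesis
  proof (cases "card L < 5")
    case True
    let ?M = "{l \<in> L. u \<notin> l}"
    interpret M: great_circles ?M a
      by (rule A.great_circles_subset) simp
    have "?M = L - A.lines u"
      using mem_a by blast
    then have "card ?M = card L - 2"
      using card_Diff_subset[OF A.finite_lines A.lines_subset] A.card_lines[OF u] by simp
    then have "card ?M \<le> 2"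
      using True by simp
    then have "card M.verts \<le> 2"
      by (rule M.card_verts_le_2)
    moreover have "arr_vertices ?M = M.verts"
      using arr[of ?M a] a by blast
    moreover have "zone_complexity L u \<le> card (arr_vertices ?M)"
      unfolding zone_complexity_def face_size_def
      using M.finite_verts \<open>arr_vertices ?M = M.verts\<close> by (intro card_mono) auto
    ultimately have "zone_complexity L u \<le> 5"
      by simp
    moreover have "u \<in> arr_vertices L"
      using arr[of L a] a u by blast
    ultimately show ?thesis
      using min by blast
  next
    case False
    obtain x where x: "\<And>l. l \<in> L \<Longrightarrow> a l \<bullet> x \<noteq> 0" "\<And>l. l \<in> L \<Longrightarrow> 0 \<le> (a l \<bullet> x) * (a l \<bullet> u)"
      using A.ex_pole[OF u] by blast
    \<comment> \<open>Rescaling turns every normal towards \<open>x\<close>: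
      \<open>N l \<bullet> x\<close> becomes the square of \<open>a l \<bullet> x\<close>.\<close>
    define N where "N l = (a l \<bullet> x) *\<^sub>R a l" for l
    have N: "N l \<noteq> 0" "l = {x \<in> S2. N l \<bullet> x = 0}" if "l \<in> L" for l
      using a[OF that] x(1)[OF that] by (auto simp: N_def)
    interpret line_arrangement L N
      using circles[OF N] False by (simp add: line_arrangement_def line_arrangement_axioms_def)
    have arr_L: "arr_vertices L = verts"
      using arr[of L N] N by blast
    have pole: "0 < N l \<bullet> x" if "l \<in> L" for l
      using x(1)[OF that] by (auto simp: N_def zero_less_mult_iff linorder_neq_iff)
    have "u \<in> verts"
      using arr_L arr[of L a] a u by blast
    then have "inc u L"
      using x(2) by (simp add: inc_def N_def)
    then obtain v where v: "v \<in> verts" "(\<Sum>c | inc v c. deg c) \<le> 17"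
      using ex_small_vertex[OF pole] by blast
    have mem: "w \<in> l \<longleftrightarrow> norm w = 1 \<and> l \<in> lines w" if "l \<in> L" for l w
      using N(2)[OF that] that by (auto simp: S2_def lines_def)
    let ?M = "{l \<in> L. v \<notin> l}"
    let ?Z = "{w \<in> verts. lines w \<inter> lines v = {} \<and> (\<forall>l\<in>L. 0 \<le> (N l \<bullet> v) * (N l \<bullet> w))}"
    \<comment> \<open>An inclusion suffices, since only an upper bound on the size of the face is
      wanted.\<close>
    have "{w \<in> arr_vertices ?M. w \<in> closure (face_at ?M v)} \<subseteq> ?Z"
    proof clarify
      fix w assume w: "w \<in> arr_vertices ?M" "w \<in> closure (face_at ?M v)"
      obtain l m where lm: "l \<in> ?M" "m \<in> ?M" "l \<noteq> m" "w \<in> l" "w \<in> m"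
        using w(1) by (auto simp: arr_vertices_def)
      have wv: "w \<in> verts"
        using lm arr_L unfolding arr_vertices_def by blast
      have "lines w = {l, m}"
        using on_two_lines[OF wv _ _ lm(3)] lm mem by blast
      moreover have "l \<notin> lines v" "m \<notin> lines v"
        using lm(1,2) mem verts_norm[OF v(1)] by blast+
      ultimately have disj: "lines w \<inter> lines v = {}"
        by simp
      have "0 \<le> (N k \<bullet> v) * (N k \<bullet> w)" if k: "k \<in> L" for k
      proof (cases "v \<in> k")
        case True
        then have "N k \<bullet> v = 0"
          using N(2)[OF k] by blast
        then show ?thesis by simp
      next
        case nv: False
        have "v \<in> S2 - \<Union>?M"
          using verts_norm[OF v(1)] by (auto simp: S2_def)
        then show ?thesis
          using closure_face_same_side[OF _ N(2)[OF k] _ w(2)] nv k by blast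
      qed
      then show "w \<in> verts \<and> lines w \<inter> lines v = {} \<and> (\<forall>l\<in>L. 0 \<le> (N l \<bullet> v) * (N l \<bullet> w))"
        using wv disj by blast
    qed
    then have "zone_complexity L v \<le> card ?Z"
      unfolding zone_complexity_def face_size_def using finite_verts by (intro card_mono) auto
    also have "\<dots> \<le> 5"
      using zone_card[OF v(1)] v(2) by linarith
    finally show ?thesis
      using min v(1) arr_L by blast
  qed
qed

end
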